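(* Assume that $n \alpha_n \to 0$ as $n\to\infty$. Then, for all $0<x<1$, $$P \left[M_n^{n \alpha_n} \leq x\right] \to x\quad\text{as } n\to\infty.$$
   Context: Let $(\alpha_n)_{n\ge 1}$ be a sequence of positive real numbers. For each $n$, let $Y_{1n},\ldots,Y_{nn}$ be i.i.d. random variables with the Gamma$(\alpha_n,1)$ distribution, i.e. with density $u^{\alpha_n-1}e^{-u}/\Gamma(\alpha_n)$ on $(0,\infty)$, and let $M_n=\max\{Y_{1n},\ldots,Y_{nn}\}$. *)

theory Defs
  imports "HOL-Probability.Probability"
begin

definition gamma_density :: "real \<Rightarrow> real \<Rightarrow> real" where
  "gamma_density a u = (if 0 < u then u powr (a - 1) * exp (- u) / Gamma a else 0)"

text \<open>
  \<open>Y\<close> is a triangular array: \<open>Y n i\<close> is the $i$-th variable of row \<open>n\<close>. Each row may live on its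
  own probability space. \<open>row_max Y n\<close> is meaningful only for \<open>n \<ge> 1\<close>.
\<close>

definition row_max :: "(nat \<Rightarrow> nat \<Rightarrow> 'a \<Rightarrow> real) \<Rightarrow> nat \<Rightarrow> 'a \<Rightarrow> real" where
  "row_max Y n \<omega> = Max ((\<lambda>i. Y n i \<omega>) ` {1..n})"

end

theory Submission
  imports Defs
begin

text \<open>
  Put \<open>c = n * \<alpha> n\<close> and \<open>t = x powr (1 / c)\<close>, so that \<open>0 < t < 1\<close>. Almost surely the event is
  \<open>row_max Y n \<le> t\<close>, whose probability is the \<open>n\<close>-th power of the Gamma distribution function at
  \<open>t\<close>. Bounding \<open>exp (- u)\<close> between \<open>1 - u\<close> and \<open>1\<close> in the density and using \<open>t powr c = x\<close>, this
  power lies between \<open>(1 - c) * x / Gamma (1 + \<alpha> n) ^ n\<close> and \<open>x / Gamma (1 + \<alpha> n) ^ n\<close>. Since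
  \<open>c \<longlonglongrightarrow> 0\<close>, differentiability of \<open>ln_Gamma\<close> at 1 gives \<open>Gamma (1 + \<alpha> n) ^ n \<longlonglongrightarrow> 1\<close>.
\<close>

lemma gamma_density_measurable [measurable]: "gamma_density a \<in> borel_measurable borel"
  unfolding gamma_density_def by measurable

lemma Gamma_1_plus: "a > 0 \<Longrightarrow> Gamma (1 + a) = a * Gamma (a :: real)"
  using Gamma_plus1[of a] nonpos_Ints_nonpos[of a] by (auto simp: add.commute)

text \<open>For positive \<open>u\<close> the factor \<open>exp (- u)\<close> is at most 1; dropping
  it leaves a pure power integral with value \<open>t powr a / (a * Gamma a)\<close>, and
  \<open>a * Gamma a = Gamma (1 + a)\<close>.\<close>

lemma nn_integral_gamma_density_le:
  assumes a: "a > 0" and t: "0 \<le> t"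
  shows "(\<integral>\<^sup>+u. ennreal (gamma_density a u) * indicator {..t} u \<partial>lborel)
    \<le> ennreal (t powr a / Gamma (1 + a))"
proof -
  have "((\<lambda>u. u powr (a - 1) / Gamma a) has_integral (t powr (a - 1 + 1) / (a - 1 + 1)) / Gamma a) {0..t}"
    by (intro has_integral_divide has_integral_powr_from_0) (use a t in auto)
  then have I: "((\<lambda>u. u powr (a - 1) / Gamma a) has_integral t powr a / Gamma (1 + a)) {0..t}"
    using a by (simp add: Gamma_1_plus)
  have "(\<integral>\<^sup>+u. ennreal (gamma_density a u) * indicator {..t} u \<partial>lborel)
      \<le> (\<integral>\<^sup>+u. ennreal (indicator {0..t} u * (u powr (a - 1) / Gamma a)) \<partial>lborel)"
    using a Gamma_real_pos[of a]
    by (intro nn_integral_mono)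
       (auto simp: gamma_density_def split: split_indicator
         intro!: ennreal_leI divide_right_mono mult_left_le)
  also have "\<dots> = ennreal (t powr a / Gamma (1 + a))"
    using nn_integral_has_integral_lebesgue[OF _ I] a by simp
  finally show ?thesis .
qed

text \<open>The bound \<open>exp (- u) \<ge> 1 - u\<close> leaves a difference of two power
  integrals. The loss against the upper bound is put in the form \<open>1 - a * t\<close>, ready for
  Bernoulli's inequality once an \<open>n\<close>-th power is taken.\<close>

lemma nn_integral_gamma_density_ge:
  assumes a: "a > 0" and t: "0 \<le> t" "t \<le> 1"
  shows "ennreal (t powr a / Gamma (1 + a) * (1 - a * t))
    \<le> (\<integral>\<^sup>+u. ennreal (gamma_density a u) * indicator {..t} u \<partial>lborel)"
proof -
  let ?f = "\<lambda>u. (u powr (a - 1) - u powr a) / Gamma a"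
  let ?I = "(t powr (a - 1 + 1) / (a - 1 + 1) - t powr (a + 1) / (a + 1)) / Gamma a"
  have I: "(?f has_integral ?I) {0..t}"
    by (intro has_integral_divide has_integral_diff has_integral_powr_from_0) (use a t in auto)
  have nonneg: "0 \<le> ?f u" if "u \<in> {0..t}" for u
    using that a t by (auto intro!: divide_nonneg_pos powr_mono')
  \<comment> \<open>The exact relative loss is \<open>a * t / (a + 1)\<close>; it is weakened to
    \<open>a * t\<close>.\<close>
  have "t powr a * (a * t / (a + 1)) \<le> t powr a * (a * t)"
    using a t by (intro mult_left_mono) (auto simp: field_simps)
  then have "t powr a / Gamma (1 + a) * (1 - a * t)
      \<le> (t powr a - t powr a * (a * t / (a + 1))) / Gamma (1 + a)"
    using a by (simp add: algebra_simps divide_right_mono flip: diff_divide_distrib)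
  also have "\<dots> = ?I"
  proof -
    have "t powr (a + 1) = t powr a * t"
      using t by (cases "t = 0") (auto simp: powr_add)
    then show ?thesis
      using a Gamma_real_pos[of a] by (simp add: Gamma_1_plus field_simps)
  qed
  finally have "ennreal (t powr a / Gamma (1 + a) * (1 - a * t)) \<le> ennreal ?I"
    by (rule ennreal_leI)
  also have "\<dots> = (\<integral>\<^sup>+u. ennreal (indicator {0..t} u * ?f u) \<partial>lborel)"
    by (rule nn_integral_has_integral_lebesgue[OF nonneg I, symmetric])
  also have "\<dots> \<le> (\<integral>\<^sup>+u. ennreal (gamma_density a u) * indicator {..t} u \<partial>lborel)"
  proof (intro nn_integral_mono)
    fix u :: real
    show "ennreal (indicator {0..t} u * ?f u) \<le> ennreal (gamma_density a u) * indicator {..t} u"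
    proof (cases "0 < u \<and> u \<le> t")
      case True
      have "u powr (a - 1) - u powr a = u powr (a - 1) * (1 - u)"
        using True by (simp add: powr_diff field_simps)
      also have "\<dots> \<le> u powr (a - 1) * exp (- u)"
        using exp_ge_add_one_self[of "-u"] by (intro mult_left_mono) auto
      finally show ?thesis
        using True a Gamma_real_pos[of a]
        by (auto simp: gamma_density_def intro!: ennreal_leI divide_right_mono)
    \<comment> \<open>In the remaining cases the left side is 0; at \<open>u = 0\<close> this relies
      on \<open>0 powr b = 0\<close>.\<close>
    qed (auto simp: indicator_def)
  qed
  finally show ?thesis .
qed

text \<open>The logarithm of the power is \<open>n * a n\<close> times the difference quotient of
  \<open>ln_Gamma\<close> at 1 with increment \<open>a n\<close>. The first factor tends to 0 and
  the second to \<open>Digamma 1\<close>, so the product tends to 0.\<close>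

lemma Gamma_power_tendsto_1:
  fixes a :: "nat \<Rightarrow> real"
  assumes pos: "\<And>n. n \<ge> 1 \<Longrightarrow> a n > 0" and lim: "(\<lambda>n. real n * a n) \<longlonglongrightarrow> 0"
  shows "(\<lambda>n. Gamma (1 + a n) ^ n) \<longlonglongrightarrow> 1"
proof -
  have ev: "eventually (\<lambda>n. n \<ge> 1 \<and> a n > 0) sequentially"
    using eventually_ge_at_top[of "1::nat"] by eventually_elim (use pos in auto)
  have "a \<longlonglongrightarrow> 0"
  proof (rule tendsto_sandwich[OF _ _ tendsto_const lim])
    show "eventually (\<lambda>n. a n \<le> real n * a n) sequentially"
      using ev by eventually_elim auto
  qed (use ev in \<open>auto elim: eventually_mono\<close>)
  \<comment> \<open>Positivity of \<open>a n\<close> keeps the increment away from 0, as the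
    punctured filter demands.\<close>
  then have "filterlim a (at 0) sequentially"
    using ev by (auto simp: filterlim_at elim: eventually_mono)
  moreover have "((\<lambda>h. (ln_Gamma (1 + h) - ln_Gamma 1) / h) \<longlongrightarrow> Digamma 1) (at (0::real))"
    using has_field_derivative_ln_Gamma_real[of 1] unfolding DERIV_def by simp
  ultimately have "(\<lambda>n. (ln_Gamma (1 + a n) - ln_Gamma 1) / a n) \<longlonglongrightarrow> Digamma 1"
    by (rule filterlim_compose[rotated])
  then have "(\<lambda>n. exp ((real n * a n) * ((ln_Gamma (1 + a n) - ln_Gamma 1) / a n))) \<longlonglongrightarrow> exp (0 * Digamma 1)"
    by (intro tendsto_intros lim)
  also have "exp (0 * Digamma 1) = (1::real)"
    by simp
  finally show ?thesis
  proof (rule Lim_transform_eventually)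
    show "eventually (\<lambda>n. exp ((real n * a n) * ((ln_Gamma (1 + a n) - ln_Gamma 1) / a n))
        = Gamma (1 + a n) ^ n) sequentially"
      using ev by eventually_elim (simp add: ln_Gamma_real_pos exp_of_nat_mult)
  qed
qed

lemma (in prob_space) prob_gamma_le_bounds:
  assumes D: "distributed M lborel X (\<lambda>u. ennreal (gamma_density a u))"
    and a: "a > 0" and t: "0 \<le> t" "t \<le> 1"
  shows "prob (X -` {..t} \<inter> space M) \<le> t powr a / Gamma (1 + a)"
    and "t powr a / Gamma (1 + a) * (1 - a * t) \<le> prob (X -` {..t} \<inter> space M)"
proof -
  have G: "Gamma (1 + a) > 0"
    using a by (intro Gamma_real_pos) auto
  have eq: "ennreal (prob (X -` {..t} \<inter> space M)) =
      (\<integral>\<^sup>+u. ennreal (gamma_density a u) * indicator {..t} u \<partial>lborel)"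
    using distributed_emeasure[OF D, of "{..t}"] by (simp add: emeasure_eq_measure)
  show "prob (X -` {..t} \<inter> space M) \<le> t powr a / Gamma (1 + a)"
    using nn_integral_gamma_density_le[OF a t(1)] G by (simp flip: eq)
  show "t powr a / Gamma (1 + a) * (1 - a * t) \<le> prob (X -` {..t} \<inter> space M)"
    using nn_integral_gamma_density_ge[OF a t]
    \<comment> \<open>Since \<open>ennreal\<close> sends negative reals to 0, a nonpositive lower
      bound is a separate case, settled by nonnegativity of the measure.\<close>
    by (simp add: ennreal_le_iff2 flip: eq) (use measure_nonneg order_trans in blast)
qed

text \<open>The density vanishes on \<open>{..0}\<close>. Positivity is what allows powers of the
  row maximum to be compared by monotonicity of \<open>powr\<close>.\<close>

lemma (in prob_space) AE_gamma_pos: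
  assumes D: "distributed M lborel X (\<lambda>u. ennreal (gamma_density a u))"
  shows "AE \<omega> in M. X \<omega> > 0"
proof (rule AE_I)
  have X [measurable]: "X \<in> borel_measurable M"
    using distributed_measurable[OF D] by simp
  have "emeasure M (X -` {..0} \<inter> space M) =
      (\<integral>\<^sup>+u. ennreal (gamma_density a u) * indicator {..0} u \<partial>lborel)"
    by (rule distributed_emeasure[OF D]) simp
  also have "\<dots> = (\<integral>\<^sup>+u. 0 \<partial>(lborel :: real measure))"
    by (intro nn_integral_cong) (auto simp: gamma_density_def indicator_def)
  finally show "emeasure M (X -` {..0} \<inter> space M) = 0"
    by simp
  show "X -` {..0} \<inter> space M \<in> events"
    by measurable
qed auto

text \<open>On positive reals \<open>powr c\<close> is strictly increasing, so almost surely the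
  event says that every entry of the row is at most \<open>x powr (1 / c)\<close>; independence then
  gives the product.\<close>

lemma (in prob_space) prob_row_max_powr_le:
  assumes n: "n \<ge> 1" and c: "c > 0" and x: "x > 0"
    and indep: "indep_vars (\<lambda>_. borel) (Y n) {1..n}"
    and pos: "\<And>i. i \<in> {1..n} \<Longrightarrow> AE \<omega> in M. Y n i \<omega> > 0"
  shows "prob {\<omega> \<in> space M. row_max Y n \<omega> powr c \<le> x} =
    (\<Prod>i=1..n. prob (Y n i -` {..x powr (1 / c)} \<inter> space M))"
proof -
  have Y [measurable]: "Y n i \<in> borel_measurable M" if "i \<in> {1..n}" for i
    using indep that by (auto simp: indep_vars_def)
  have R [measurable]: "row_max Y n \<in> borel_measurable M"
    unfolding row_max_def by (intro borel_measurable_Max) (auto intro: Y)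
  let ?t = "x powr (1 / c)"
  let ?B = "\<Inter>i\<in>{1..n}. Y n i -` {..?t} \<inter> space M"
  have "AE \<omega> in M. \<forall>i\<in>{1..n}. Y n i \<omega> > 0"
    by (rule AE_finite_allI) (auto intro: pos)
  then have "AE \<omega> in M. \<omega> \<in> {\<omega> \<in> space M. row_max Y n \<omega> powr c \<le> x} \<longleftrightarrow> \<omega> \<in> ?B"
    using AE_space
  proof eventually_elim
    case (elim \<omega>)
    have "row_max Y n \<omega> > 0"
      using elim n unfolding row_max_def by (subst Max_gr_iff) auto
    moreover have "x = ?t powr c"
      using c x by (simp add: powr_powr)
    ultimately have "row_max Y n \<omega> powr c \<le> x \<longleftrightarrow> row_max Y n \<omega> \<le> ?t"
      using c x
      by (metis less_eq_real_def not_less powr_ge_zero powr_less_mono2 powr_mono2)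
    also have "\<dots> \<longleftrightarrow> (\<forall>i\<in>{1..n}. Y n i \<omega> \<le> ?t)"
      using n unfolding row_max_def by (subst Max_le_iff) auto
    finally show ?case
      using elim n by auto
  qed
  then have "prob {\<omega> \<in> space M. row_max Y n \<omega> powr c \<le> x} = prob ?B"
    by (rule finite_measure_eq_AE)
       (use n in \<open>auto intro!: sets.finite_INT measurable_sets[OF Y]\<close>)
  also have "\<dots> = (\<Prod>i\<in>{1..n}. prob (Y n i -` {..?t} \<inter> space M))"
    by (rule indep_varsD[OF indep]) (use n in auto)
  finally show ?thesis .
qed

theorem theorem2p7:
  fixes \<alpha> :: "nat \<Rightarrow> real"
    and P :: "nat \<Rightarrow> 'a measure"
    and Y :: "nat \<Rightarrow> nat \<Rightarrow> 'a \<Rightarrow> real"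
    and x :: real
  assumes alpha_pos: "\<And>n. n \<ge> 1 \<Longrightarrow> \<alpha> n > 0"
    and prob: "\<And>n. n \<ge> 1 \<Longrightarrow> prob_space (P n)"
    and indep: "\<And>n. n \<ge> 1 \<Longrightarrow> prob_space.indep_vars (P n) (\<lambda>_. borel) (Y n) {1..n}"
    and gamma: "\<And>n i. n \<ge> 1 \<Longrightarrow> i \<in> {1..n} \<Longrightarrow>
      distributed (P n) lborel (Y n i) (\<lambda>u. ennreal (gamma_density (\<alpha> n) u))"
    and lim: "(\<lambda>n. real n * \<alpha> n) \<longlonglongrightarrow> 0"
    and x: "0 < x" "x < 1"
  shows "(\<lambda>n. measure (P n) {\<omega> \<in> space (P n). row_max Y n \<omega> powr (real n * \<alpha> n) \<le> x})
    \<longlonglongrightarrow> x"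
proof (rule tendsto_sandwich)
  let ?c = "\<lambda>n. real n * \<alpha> n"
  let ?p = "\<lambda>n. measure (P n) {\<omega> \<in> space (P n). row_max Y n \<omega> powr ?c n \<le> x}"
  let ?G = "\<lambda>n. Gamma (1 + \<alpha> n) ^ n"
  \<comment> \<open>The restriction \<open>?c n < 1\<close> ensures
    \<open>\<alpha> n * t \<le> 1\<close>, which both Bernoulli's inequality and the factorwise
    lower bound of the product use.\<close>
  have bounds: "x / ?G n * (1 - ?c n) \<le> ?p n \<and> ?p n \<le> x / ?G n" if n: "n \<ge> 1" "?c n < 1" for n
  proof -
    interpret prob_space "P n"
      by (rule prob) fact
    define t where "t = x powr (1 / ?c n)"
    have a: "\<alpha> n > 0"
      by (rule alpha_pos) fact
    with n have c: "?c n > 0"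
      by simp
    have t: "0 \<le> t" "t \<le> 1"
      using x c by (auto simp: t_def intro!: powr_le1)
    have tc: "(t powr \<alpha> n) ^ n = x"
      using x n a c by (simp add: t_def powr_powr flip: powr_realpow)
    have G: "Gamma (1 + \<alpha> n) > 0"
      using a by (intro Gamma_real_pos) auto
    have at: "\<alpha> n * t \<le> \<alpha> n" "0 \<le> \<alpha> n * t"
      using a t by (auto intro: mult_left_le)
    have "\<alpha> n \<le> ?c n"
      using a n by simp
    with at n have at1: "\<alpha> n * t \<le> 1"
      by linarith
    have p: "?p n = (\<Prod>i=1..n. prob (Y n i -` {..t} \<inter> space (P n)))"
      unfolding t_def
      by (rule prob_row_max_powr_le[where Y = Y, OF n(1) c x(1) indep[OF n(1)]])
         (rule AE_gamma_pos[OF gamma[OF n(1)]])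
    note bd = prob_gamma_le_bounds[OF gamma[OF n(1)] a t]
    have "?p n \<le> (\<Prod>i=1..n. t powr \<alpha> n / Gamma (1 + \<alpha> n))"
      unfolding p by (intro prod_mono) (auto intro: bd)
    also have "\<dots> = x / ?G n"
      by (simp add: power_divide tc)
    finally have upper: "?p n \<le> x / ?G n" .
    \<comment> \<open>As \<open>t \<le> 1\<close>, the first-order Bernoulli term
      \<open>n * \<alpha> n * t\<close> is at most \<open>?c n\<close>, which removes
      \<open>t\<close> from the bound.\<close>
    have "1 - ?c n \<le> 1 + real n * (- (\<alpha> n * t))"
      using at by (simp add: mult_left_mono)
    also have "\<dots> \<le> (1 + - (\<alpha> n * t)) ^ n"
      by (rule Bernoulli_inequality) (use at1 in simp)
    finally have "x / ?G n * (1 - ?c n) \<le> x / ?G n * (1 - \<alpha> n * t) ^ n"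
      using x G by (intro mult_left_mono) auto
    also have "\<dots> = (\<Prod>i=1..n. t powr \<alpha> n / Gamma (1 + \<alpha> n) * (1 - \<alpha> n * t))"
      by (simp add: power_divide power_mult_distrib tc)
    also have "\<dots> \<le> ?p n"
      unfolding p using at1 G by (intro prod_mono conjI bd mult_nonneg_nonneg) auto
    finally show ?thesis
      using upper by blast
  qed
  have ev: "eventually (\<lambda>n. n \<ge> 1 \<and> ?c n < 1) sequentially"
    using eventually_ge_at_top[of "1::nat"] order_tendstoD(2)[OF lim, of 1]
    by (simp add: eventually_conj_iff)
  show "eventually (\<lambda>n. x / ?G n * (1 - ?c n) \<le> ?p n) sequentially"
    using ev by eventually_elim (use bounds in blast)
  show "eventually (\<lambda>n. ?p n \<le> x / ?G n) sequentially"
    using ev by eventually_elim (use bounds in blast)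
  have lim_upper: "(\<lambda>n. x / ?G n) \<longlonglongrightarrow> x / 1"
    by (intro tendsto_intros Gamma_power_tendsto_1 alpha_pos lim) auto
  then show "(\<lambda>n. x / ?G n) \<longlonglongrightarrow> x"
    by simp
  have "(\<lambda>n. x / ?G n * (1 - ?c n)) \<longlonglongrightarrow> x / 1 * (1 - 0)"
    by (intro tendsto_mult tendsto_diff lim_upper tendsto_const lim)
  then show "(\<lambda>n. x / ?G n * (1 - ?c n)) \<longlonglongrightarrow> x"
    by simp
qed

end
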